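(* Let $\{a_n\}_{n\ge1}$ be a sequence of positive real numbers such that the logarithmic differences $$\Delta\log a_n=\log a_{n+1}-\log a_n$$ satisfy $$\Delta\log a_n\to\infty\quad(n\to\infty)$$ and $$\Delta\log a_{n+1}=\Delta\log a_n+O\left(\frac1n\right)\quad(n\to\infty).$$ Then: (i) $\{a_n\}$ is not locally Benford distributed of order $k$ for any integer $k\ge2$. (ii) $\{a_n\}$ does not have Benford distributed waiting times.
   Context: For a positive real number $x$, the leading digit $D(x)\in\{1,2,\dots,9\}$ of $x$ in base $10$ is defined by: $D(x)=d$ if and only if $d\cdot 10^k\le x<(d+1)\cdot 10^k$ for some $k\in\mathbb{Z}$. For $d\in\{1,\dots,9\}$ let $P(d)=\log_{10}(1+1/d)$. Local Benford distribution: for a positive integer $k$, a sequence $\{a_n\}_{n\ge1}$ of positive real numbers is called locally Benford distributed of order $k$ if $$\lim_{N\to\infty}\frac1N\#\{n\le N: D(a_{n+i})=d_i\ (i=0,1,\dots,k-1)\}=P(d_0)P(d_1)\cdots P(d_{k-1})$$ for all choices of $d_0,\dots,d_{k-1}\in\{1,\dots,9\}$. Benford distributed waiting times: given a sequence $\{a_n\}_{n\ge1}$ of positive real numbers and $d\in\{1,\dots,9\}$, let $n_1^{(d)}<n_2^{(d)}<n_3^{(d)}<\cdots$ be the elements of $\{n\in\mathbb{N}: D(a_n)=d\}$ listed in increasing order, and let $w_i(d)=n_{i+1}^{(d)}-n_i^{(d)}$. The sequence $\{a_n\}$ is said to have Benford distributed waiting times if $$\lim_{N\to\infty}\frac1N\#\{i\le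 N: w_i(d)=k\}=P(d)(1-P(d))^{k-1}$$ for all $d\in\{1,\dots,9\}$ and all $k=1,2,\dots$ (so that, in particular, each set $\{n\in\mathbb{N}: D(a_n)=d\}$ has to be infinite). $\log$ denotes the natural logarithm. *)

theory Defs
  imports "HOL-Analysis.Analysis" "HOL-Library.Infinite_Set" "HOL-Library.Landau_Symbols"
begin

text \<open>Sequences are functions \<open>a :: nat \<Rightarrow> real\<close> indexed from 1; the value \<open>a 0\<close> is never used.\<close>

definition has_leading_digit :: "real \<Rightarrow> nat \<Rightarrow> bool" where
  "has_leading_digit x d \<longleftrightarrow>
     d \<in> {1..9} \<and> (\<exists>k::int. real d * 10 powi k \<le> x \<and> x < (real d + 1) * 10 powi k)"

definition leading_digit :: "real \<Rightarrow> nat" where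
  "leading_digit x = (THE d. has_leading_digit x d)"

lemma has_leading_digit_unique:
  assumes "has_leading_digit x d" and "has_leading_digit x e"
  shows "d = e"
proof -
  obtain k where d: "d \<in> {1..9}" and k: "real d * 10 powi k \<le> x" "x < (real d + 1) * 10 powi k"
    using assms(1) unfolding has_leading_digit_def by blast
  obtain l where e: "e \<in> {1..9}" and l: "real e * 10 powi l \<le> x" "x < (real e + 1) * 10 powi l"
    using assms(2) unfolding has_leading_digit_def by blast
  have scale: "10 powi m \<le> x \<and> x < 10 powi (m + 1)"
    if f: "f \<in> {1..9}" and m: "real f * 10 powi m \<le> x" "x < (real f + 1) * 10 powi m"
    for f :: nat and m :: int
  proof -
    have pos: "(0::real) < 10 powi m" by simp
    have "1 * (10::real) powi m \<le> real f * 10 powi m"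
      using f pos by (intro mult_right_mono) auto
    moreover have "(real f + 1) * (10::real) powi m \<le> 10 * 10 powi m"
      using f pos by (intro mult_right_mono) auto
    moreover have "(10::real) powi (m + 1) = 10 * 10 powi m"
      by (simp add: power_int_add)
    ultimately show ?thesis using m by linarith
  qed
  have exp_le: "m \<le> n" if "(10::real) powi m \<le> x" "x < 10 powi (n + 1)" for m n :: int
  proof (rule ccontr)
    assume "\<not> m \<le> n"
    then have "(10::real) powi (n + 1) \<le> 10 powi m"
      by (intro power_int_increasing) auto
    with that show False by linarith
  qed
  have "k = l"
    using exp_le[of k l] exp_le[of l k] scale[OF d k] scale[OF e l] by linarith
  moreover have pos: "(0::real) < 10 powi l" by simp
  ultimately have "real d < real e + 1" "real e < real d + 1"
    using k l by (metis le_less_trans mult_less_cancel_right_pos)+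
  then show "d = e" by linarith
qed

lemma has_leading_digit_exists:
  assumes "x > 0"
  shows "\<exists>d. has_leading_digit x d"
proof -
  define k where "k = \<lfloor>log 10 x\<rfloor>"
  define y where "y = x / 10 powi k"
  have pow: "10 powr real_of_int m = (10::real) powi m" for m
    by (simp add: powr_real_of_int')
  have "10 powr real_of_int k \<le> x"
    using assms by (simp add: k_def flip: le_log_iff)
  moreover have "x < 10 powr real_of_int (k + 1)"
    using assms by (simp add: k_def flip: log_less_iff)
  ultimately have b: "10 powi k \<le> x" "x < 10 powi k * 10"
    unfolding pow by (simp_all add: power_int_add)
  have pos: "(0::real) < 10 powi k" by simp
  have y: "1 \<le> y" "y < 10"
    using b pos by (simp_all add: y_def divide_simps mult.commute)
  have fl: "real (nat \<lfloor>y\<rfloor>) \<le> y" "y < real (nat \<lfloor>y\<rfloor>) + 1"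
    using y by linarith+
  have "nat \<lfloor>y\<rfloor> \<in> {1..9}"
    using y by (auto simp: le_nat_iff nat_le_iff le_floor_iff floor_le_iff)
  moreover have "x = y * 10 powi k" by (simp add: y_def)
  ultimately have "has_leading_digit x (nat \<lfloor>y\<rfloor>)"
    unfolding has_leading_digit_def using fl pos
    by (intro conjI exI[of _ k]) (auto intro: mult_right_mono mult_strict_right_mono)
  then show ?thesis ..
qed

lemma leading_digit_iff:
  assumes "x > 0"
  shows "leading_digit x = d \<longleftrightarrow>
    d \<in> {1..9} \<and> (\<exists>k::int. real d * 10 powi k \<le> x \<and> x < (real d + 1) * 10 powi k)"
proof -
  have "\<exists>!d. has_leading_digit x d"
    using has_leading_digit_exists[OF assms] has_leading_digit_unique by blast
  then have "leading_digit x = d \<longleftrightarrow> has_leading_digit x d"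
    unfolding leading_digit_def by (metis theI')
  then show ?thesis by (simp add: has_leading_digit_def)
qed

definition benford_prob :: "nat \<Rightarrow> real" where
  "benford_prob d = log 10 (1 + 1 / real d)"

definition locally_benford :: "nat \<Rightarrow> (nat \<Rightarrow> real) \<Rightarrow> bool" where
  "locally_benford k a \<longleftrightarrow>
     (\<forall>d :: nat \<Rightarrow> nat. (\<forall>i<k. d i \<in> {1..9}) \<longrightarrow>
        (\<lambda>N. real (card {n \<in> {1..N}. \<forall>i<k. leading_digit (a (n + i)) = d i}) / real N)
          \<longlonglongrightarrow> (\<Prod>i<k. benford_prob (d i)))"

definition digit_indices :: "(nat \<Rightarrow> real) \<Rightarrow> nat \<Rightarrow> nat set" where
  "digit_indices a d = {n. n \<ge> 1 \<and> leading_digit (a n) = d}"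

text \<open>The \<open>i\<close>-th occurrence (\<open>i \<ge> 1\<close>) of the leading digit \<open>d\<close>. The library's
  \<open>enumerate\<close> counts from 0, hence the shift; the value is meaningful only if the set
  \<open>digit_indices a d\<close> is infinite.\<close>

definition digit_occurrence :: "(nat \<Rightarrow> real) \<Rightarrow> nat \<Rightarrow> nat \<Rightarrow> nat" where
  "digit_occurrence a d i = enumerate (digit_indices a d) (i - 1)"

definition waiting_time :: "(nat \<Rightarrow> real) \<Rightarrow> nat \<Rightarrow> nat \<Rightarrow> nat" where
  "waiting_time a d i = digit_occurrence a d (i + 1) - digit_occurrence a d i"

definition benford_waiting_times :: "(nat \<Rightarrow> real) \<Rightarrow> bool" where
  "benford_waiting_times a \<longleftrightarrow>
     (\<forall>d\<in>{1..9}. infinite (digit_indices a d) \<and>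
        (\<forall>k\<ge>1. (\<lambda>N. real (card {i \<in> {1..N}. waiting_time a d i = k}) / real N)
                  \<longlonglongrightarrow> benford_prob d * (1 - benford_prob d) ^ (k - 1)))"

definition log_diff :: "(nat \<Rightarrow> real) \<Rightarrow> nat \<Rightarrow> real" where
  "log_diff a n = ln (a (n + 1)) - ln (a n)"

end

theory Submission
  imports Defs
begin

text \<open>Since the increments \<open>\<Delta> log\<^sub>1\<^sub>0 a\<^sub>n\<close> tend to infinity with steps \<open>O(1/n)\<close>,
  infinitely often they stay close to \<open>2/5\<close> modulo 1 on a whole window
  \<open>{N..(1 + \<epsilon>) N}\<close>. On such a window the fractional part of \<open>log\<^sub>1\<^sub>0 a\<^sub>n\<close> moves almost like
  the rotation by \<open>2/5\<close>. As \<open>3/10 < log\<^sub>1\<^sub>0 2 < 1/3\<close>, the digit 1 then never occurs twice in a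
  row, but it occurs at least once among any five consecutive terms. The first fact makes the
  pattern \<open>1, 1, \<dots>, 1\<close> have no positive density; both facts together give a positive proportion
  of consecutive occurrences of the digit 1 without a waiting time equal to 1.\<close>

section \<open>Slowly varying sequences modulo 1\<close>

text \<open>When \<open>u\<close> first passes a level \<open>m + \<theta>\<close>, it overshoots by
  at most one step; afterwards, steps of size \<open>O(1/n)\<close> need a fixed proportion of
  \<open>N\<close> indices to move \<open>u\<close> noticeably. Hence \<open>\<epsilon>\<close>
  depends only on \<open>\<eta>\<close> and the implied constant, not on \<open>M\<close>.\<close>

lemma windows_near_residue:
  fixes u :: "nat \<Rightarrow> real" and \<theta> \<eta> :: real
  assumes top: "filterlim u at_top sequentially"
    and slow: "(\<lambda>n. u (n + 1) - u n) \<in> O(\<lambda>n. 1 / real n)"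
    and \<eta>: "\<eta> > 0"
  shows "\<exists>\<epsilon>>0. \<forall>M. \<exists>N\<ge>M. \<exists>N' (m::int). (1 + \<epsilon>) * real N \<le> real N' \<and>
           (\<forall>n\<in>{N..N'}. \<bar>u n - m - \<theta>\<bar> \<le> \<eta>)"
proof -
  obtain C where C: "C > 0" and "\<forall>\<^sub>F n in sequentially. norm (u (n + 1) - u n) \<le> C * norm (1 / real n)"
    using landau_o.bigE[OF slow] by blast
  then obtain n0 where n0: "\<And>n. n \<ge> n0 \<Longrightarrow> \<bar>u (n + 1) - u n\<bar> \<le> C / real n"
    by (auto simp: eventually_sequentially)
  have step: "\<bar>u (n + 1) - u n\<bar> \<le> C / real K" if "n \<ge> n0" "n \<ge> K" "K > 0" for n K
  proof -
    have "C / real n \<le> C / real K"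
      using that C by (intro divide_left_mono) auto
    with n0[OF that(1)] show ?thesis by linarith
  qed
  \<comment> \<open>About \<open>\<epsilon> N\<close> steps of size at most \<open>C / N\<close> add
    up to \<open>\<eta> / 4\<close>; the overshoot at \<open>N\<close> and the rounding in
    \<open>N'\<close> cost at most another \<open>\<eta> / 4\<close> each.\<close>
  define \<epsilon> where "\<epsilon> = \<eta> / (4 * C)"
  have \<epsilon>: "\<epsilon> > 0" using C \<eta> by (simp add: \<epsilon>_def)
  have "\<exists>N\<ge>M. \<exists>N' (m::int). (1 + \<epsilon>) * real N \<le> real N' \<and>
          (\<forall>n\<in>{N..N'}. \<bar>u n - m - \<theta>\<bar> \<le> \<eta>)" for M
  proof -
    define K where "K = M + n0 + nat \<lceil>4 * C / \<eta>\<rceil> + 1"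
    have K: "K \<ge> n0" "K \<ge> M" "K > 0" "real K \<ge> 4 * C / \<eta>"
      unfolding K_def by linarith+
    have CK: "C / real K \<le> \<eta> / 4"
      using K \<eta> C by (simp add: field_simps)
    \<comment> \<open>The level is put above \<open>u K\<close>, so that its first passage
      \<open>N\<close> exceeds \<open>K\<close>; then \<open>u (N - 1)\<close> is still below it and
      the step bound applies at \<open>N - 1\<close>.\<close>
    define m where "m = \<lfloor>u K - \<theta>\<rfloor> + 1"
    have m: "u K < m + \<theta>" unfolding m_def by linarith
    define N where "N = (LEAST n. n \<ge> K \<and> m + \<theta> \<le> u n)"
    have "\<exists>n. n \<ge> K \<and> m + \<theta> \<le> u n"
      using top unfolding filterlim_at_top eventually_sequentially
      by (metis nle_le)
    then have N: "N \<ge> K" "m + \<theta> \<le> u N"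
      unfolding N_def by (metis (mono_tags, lifting) LeastI_ex)+
    with m have "N > K" by (metis leD le_neq_implies_less)
    then have "u (N - 1) < m + \<theta>" and N1: "N - 1 \<ge> K"
      using not_less_Least[of "N - 1" "\<lambda>n. n \<ge> K \<and> m + \<theta> \<le> u n"] K(3) N
      unfolding N_def[symmetric] by linarith+
    moreover have "\<bar>u (N - 1 + 1) - u (N - 1)\<bar> \<le> C / real K"
      using N1 K by (intro step) auto
    ultimately have uN: "\<bar>u N - m - \<theta>\<bar> \<le> \<eta> / 4"
      using CK N(2) \<open>N > K\<close> by (simp only: le_add_diff_inverse2)
    define N' where "N' = nat \<lceil>(1 + \<epsilon>) * real N\<rceil>"
    have N': "(1 + \<epsilon>) * real N \<le> real N'" "real N' \<le> (1 + \<epsilon>) * real N + 1"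
      using \<epsilon> unfolding N'_def by (auto simp: zero_le_mult_iff)
    have drift: "\<bar>u (N + j) - u N\<bar> \<le> real j * (C / real N)" for j
    proof (induction j)
      case (Suc j)
      have "\<bar>u (N + j + 1) - u (N + j)\<bar> \<le> C / real N"
        using N K by (intro step) auto
      moreover have "real (Suc j) * (C / real N) = real j * (C / real N) + C / real N"
        by (simp add: distrib_right del: times_divide_eq_right)
      ultimately show ?case using Suc by simp
    qed simp
    have "\<bar>u n - m - \<theta>\<bar> \<le> \<eta>" if "n \<in> {N..N'}" for n
    proof -
      have "real (n - N) \<le> \<epsilon> * real N + 1"
        using that N' by (auto simp: of_nat_diff algebra_simps)
      then have "real (n - N) * (C / real N) \<le> (\<epsilon> * real N + 1) * (C / real N)"
        using C by (intro mult_right_mono) auto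
      also have "\<dots> = \<eta> / 4 + C / real N"
        using C N K by (simp add: \<epsilon>_def field_simps)
      also have "C / real N \<le> C / real K"
        using N K C by (intro divide_left_mono) auto
      finally have "real (n - N) * (C / real N) \<le> \<eta> / 2"
        using CK by linarith
      moreover have "\<bar>u n - u N\<bar> \<le> real (n - N) * (C / real N)"
        using drift[of "n - N"] that by simp
      ultimately have "\<bar>u n - u N\<bar> \<le> \<eta> / 2" by linarith
      with uN \<eta> show ?thesis by linarith
    qed
    with N' N K show ?thesis by (meson order_trans)
  qed
  with \<epsilon> show ?thesis by blast
qed

section \<open>Counts of positive density\<close>

text \<open>Without an increase of the count, the ratio would drop by a factor of at least
  \<open>1 + \<epsilon>\<close> between \<open>M\<close> and \<open>M'\<close>, which a positive
  limit forbids for large \<open>M\<close>.\<close>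

lemma counts_increase_of_density:
  fixes c :: "nat \<Rightarrow> nat" and p \<epsilon> :: real
  assumes lim: "(\<lambda>N. real (c N) / real N) \<longlonglongrightarrow> p" and "p > 0" "\<epsilon> > 0"
  shows "\<exists>M0. \<forall>M\<ge>M0. \<forall>M'. (1 + \<epsilon>) * real M \<le> real M' \<longrightarrow> c M < c M'"
proof -
  \<comment> \<open>The solution of \<open>(p - \<eta>) * (1 + \<epsilon>) = p + \<eta>\<close>,
    which makes the lower bound for \<open>c M'\<close> meet the upper bound for
    \<open>c M\<close>.\<close>
  define \<eta> where "\<eta> = p * \<epsilon> / (2 + \<epsilon>)"
  have \<eta>: "\<eta> > 0" "\<eta> < p" "(p - \<eta>) * (1 + \<epsilon>) = p + \<eta>"
    using assms by (simp_all add: \<eta>_def field_simps)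
  obtain M0 where M0: "\<And>M. M \<ge> M0 \<Longrightarrow> \<bar>real (c M) / real M - p\<bar> < \<eta>"
    using LIMSEQ_D[OF lim \<eta>(1)] by auto
  have "c M < c M'" if M: "M \<ge> Suc M0" and M': "(1 + \<epsilon>) * real M \<le> real M'" for M M'
  proof -
    have "real M \<le> (1 + \<epsilon>) * real M" using assms by (simp add: algebra_simps)
    with M' M have ge: "M' \<ge> M" "M > 0" "M' > 0" by linarith+
    have "real (c M) < (p + \<eta>) * real M"
      using M0[of M] M ge by (simp add: abs_less_iff field_simps)
    also have "\<dots> = (p - \<eta>) * ((1 + \<epsilon>) * real M)"
      by (simp flip: \<eta>(3))
    also have "\<dots> \<le> (p - \<eta>) * real M'"
      using M' \<eta> by (intro mult_left_mono) auto
    also have "\<dots> < real (c M')"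
      using M0[of M'] M ge by (simp add: abs_less_iff field_simps)
    finally show ?thesis by simp
  qed
  then show ?thesis by blast
qed

section \<open>Leading digit 1 as an arc of the circle of logarithms modulo 1\<close>

lemma leading_digit_one_iff:
  assumes "x > 0"
  shows "leading_digit x = 1 \<longleftrightarrow> (\<exists>k::int. k \<le> log 10 x \<and> log 10 x < k + log 10 2)"
proof -
  have pow: "10 powr real_of_int k = (10::real) powi k" for k
    by (simp add: powr_real_of_int')
  have "k \<le> log 10 x \<longleftrightarrow> 10 powi k \<le> x" for k :: int
    using assms by (simp add: le_log_iff pow)
  moreover have "log 10 x < k + log 10 2 \<longleftrightarrow> x < 2 * 10 powi k" for k :: int
    using assms by (simp add: log_less_iff powr_add pow mult.commute)
  ultimately show ?thesis by (simp add: leading_digit_iff[OF assms])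
qed

text \<open>From \<open>10 ^ 3 \<le> 2 ^ 10\<close> and \<open>2 ^ 3 < 10\<close>. The lower bound
  makes the arc long enough to be hit, the upper one short enough to be left at once.\<close>

lemma log10_2_bounds: "3 / 10 \<le> log 10 (2::real)" "log 10 (2::real) < 1 / 3"
proof -
  have "(3::real) = log 10 (10 ^ 3)" by (subst log_nat_power) auto
  also have "\<dots> \<le> log 10 (2 ^ 10)" by simp
  also have "\<dots> = 10 * log 10 2" by (subst log_nat_power) auto
  finally show "3 / 10 \<le> log 10 (2::real)" by simp
  have "3 * log 10 (2::real) = log 10 (2 ^ 3)" by (subst log_nat_power) auto
  also have "\<dots> < 1" by (simp add: log_less_iff)
  finally show "log 10 (2::real) < 1 / 3" by simp
qed

text \<open>Two points of an arc shorter than 1/3 differ by less than 1/3 modulo 1, while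
  \<open>2/5\<close> with an error of 1/100 stays farther than that from every integer.\<close>

lemma not_both_leading_digit_one:
  assumes "x > 0" "y > 0" and near: "\<bar>log 10 y - log 10 x - real_of_int m - 2 / 5\<bar> \<le> 1 / 100"
  shows "\<not> (leading_digit x = 1 \<and> leading_digit y = 1)"
proof
  assume "leading_digit x = 1 \<and> leading_digit y = 1"
  then obtain j k :: int where "j \<le> log 10 x" "log 10 x < j + log 10 2"
    and "k \<le> log 10 y" "log 10 y < k + log 10 2"
    using assms leading_digit_one_iff by auto
  then have "0 < real_of_int (k - j - m)" "real_of_int (k - j - m) < 1"
    using near log10_2_bounds unfolding of_int_diff by linarith+
  then show False unfolding of_int_0_less_iff of_int_less_1_iff by linarith
qed

lemma leading_digit_one_within_five:
  fixes a :: "nat \<Rightarrow> real"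
  assumes pos: "\<And>i. i < 5 \<Longrightarrow> a (n + i) > 0"
    and near: "\<And>i. i < 4 \<Longrightarrow>
      \<bar>log 10 (a (n + i + 1)) - log 10 (a (n + i)) - real_of_int m - 2 / 5\<bar> \<le> 1 / 100"
  shows "\<exists>i<5. leading_digit (a (n + i)) = 1"
proof -
  define b where "b i = log 10 (a (n + i))" for i :: nat
  have b: "\<bar>b 1 - b 0 - m - 2 / 5\<bar> \<le> 1 / 100" "\<bar>b 2 - b 1 - m - 2 / 5\<bar> \<le> 1 / 100"
    "\<bar>b 3 - b 2 - m - 2 / 5\<bar> \<le> 1 / 100" "\<bar>b 4 - b 3 - m - 2 / 5\<bar> \<le> 1 / 100"
    using near[of 0] near[of 1] near[of 2] near[of 3] by (simp_all add: b_def numeral_eq_Suc)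
  have hit: ?thesis if "i < 5" "real_of_int k \<le> b i" "b i < k + 3 / 10" for i k
  proof -
    have "leading_digit (a (n + i)) = 1"
      using that pos[OF that(1)] log10_2_bounds
      by (subst leading_digit_one_iff) (auto simp: b_def intro!: exI[of _ k])
    with that show ?thesis by blast
  qed
  define j where "j = \<lfloor>b 0\<rfloor>"
  have j: "j \<le> b 0" "b 0 < j + 1" unfolding j_def by linarith+
  \<comment> \<open>The five approximate points \<open>b 0 + 2 i / 5\<close> are spaced by \<open>1/5\<close> modulo 1, so one of them
    falls into \<open>{1/25..<13/50}\<close>, which leaves room for the accumulated error \<open>4/100\<close>.\<close>
  consider "b 0 < j + 1 / 25" | "j + 1 / 25 \<le> b 0" "b 0 < j + 13 / 50"
    | "j + 13 / 50 \<le> b 0" "b 0 < j + 45 / 100" | "j + 45 / 100 \<le> b 0" "b 0 < j + 65 / 100"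
    | "j + 65 / 100 \<le> b 0" "b 0 < j + 85 / 100" | "j + 85 / 100 \<le> b 0"
    by linarith
  then show ?thesis
  proof cases
    \<comment> \<open>For the point \<open>b i\<close> the integer is \<open>j + i * m\<close> plus
      the carry from adding \<open>2 i / 5\<close>. The first and last cases use the same
      \<open>i\<close>: they are one arc modulo 1, cut at the integer.\<close>
    case 1 with b j show ?thesis by (intro hit[of 3 "j + 3 * m + 1"]) (simp, linarith+)
  next
    case 2 with b j show ?thesis by (intro hit[of 0 j]) (simp, linarith+)
  next
    case 3 with b j show ?thesis by (intro hit[of 2 "j + 2 * m + 1"]) (simp, linarith+)
  next
    case 4 with b j show ?thesis by (intro hit[of 4 "j + 4 * m + 2"]) (simp, linarith+)
  next
    case 5 with b j show ?thesis by (intro hit[of 1 "j + m + 1"]) (simp, linarith+)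
  next
    case 6 with b j show ?thesis by (intro hit[of 3 "j + 3 * m + 2"]) (simp, linarith+)
  qed
qed

lemma windows_leading_digit_one:
  fixes a :: "nat \<Rightarrow> real"
  assumes pos: "\<And>n. n \<ge> 1 \<Longrightarrow> a n > 0"
    and top: "filterlim (log_diff a) at_top sequentially"
    and slow: "(\<lambda>n. log_diff a (n + 1) - log_diff a n) \<in> O(\<lambda>n. 1 / real n)"
  obtains \<epsilon> where "\<epsilon> > 0"
    "\<And>M. \<exists>N\<ge>M. \<exists>N'. (1 + \<epsilon>) * real N \<le> real N' \<and>
       (\<forall>n\<in>{N..N'}. \<not> (leading_digit (a n) = 1 \<and> leading_digit (a (n + 1)) = 1)) \<and>
       (\<forall>n. N \<le> n \<and> n + 5 \<le> N' \<longrightarrow> (\<exists>t\<in>{n<..n + 5}. leading_digit (a t) = 1))"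
proof -
  define u where "u n = log 10 (a (n + 1)) - log 10 (a n)" for n
  have u: "u n = log_diff a n / ln 10" for n
    by (simp add: u_def log_diff_def log_def diff_divide_distrib)
  have "filterlim u at_top sequentially"
    unfolding u divide_inverse
    by (rule filterlim_at_top_mult_tendsto_pos[OF tendsto_const _ top]) simp
  moreover have "(\<lambda>n. u (n + 1) - u n) \<in> O(\<lambda>n. 1 / real n)"
    using slow by (simp add: u flip: diff_divide_distrib)
  ultimately obtain \<epsilon> where \<epsilon>: "\<epsilon> > 0" and win: "\<And>M. \<exists>N\<ge>M. \<exists>N' (m::int).
      (1 + \<epsilon>) * real N \<le> real N' \<and> (\<forall>n\<in>{N..N'}. \<bar>u n - m - 2 / 5\<bar> \<le> 1 / 100)"
    using windows_near_residue[of u "1 / 100" "2 / 5"] by auto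
  have "\<exists>N\<ge>M. \<exists>N'. (1 + \<epsilon>) * real N \<le> real N' \<and>
       (\<forall>n\<in>{N..N'}. \<not> (leading_digit (a n) = 1 \<and> leading_digit (a (n + 1)) = 1)) \<and>
       (\<forall>n. N \<le> n \<and> n + 5 \<le> N' \<longrightarrow> (\<exists>t\<in>{n<..n + 5}. leading_digit (a t) = 1))" for M
  proof -
    obtain N N' and m :: int where N: "N \<ge> Suc M" "(1 + \<epsilon>) * real N \<le> real N'"
      and near: "\<And>n. n \<in> {N..N'} \<Longrightarrow> \<bar>u n - m - 2 / 5\<bar> \<le> 1 / 100"
      \<comment> \<open>\<open>Suc M\<close> keeps the window away from index 0, where
        \<open>a\<close> need not be positive.\<close>
      using win[of "Suc M"] by blast
    have "\<not> (leading_digit (a n) = 1 \<and> leading_digit (a (n + 1)) = 1)" if "n \<in> {N..N'}" for n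
      using near[OF that] N that
      by (intro not_both_leading_digit_one[where m = m]) (auto simp: u_def intro: pos)
    moreover have "\<exists>t\<in>{n<..n + 5}. leading_digit (a t) = 1" if "N \<le> n" "n + 5 \<le> N'" for n
    proof -
      have "\<exists>i<5. leading_digit (a (n + 1 + i)) = 1"
      proof (rule leading_digit_one_within_five)
        show "\<bar>log 10 (a (n + 1 + i + 1)) - log 10 (a (n + 1 + i)) - m - 2 / 5\<bar> \<le> 1 / 100"
          if "i < 4" for i
          using near[of "n + 1 + i"] that \<open>N \<le> n\<close> \<open>n + 5 \<le> N'\<close> by (simp add: u_def)
      qed (auto intro: pos)
      then obtain i where "i < 5" "leading_digit (a (n + 1 + i)) = 1" by blast
      then show ?thesis by (intro bexI[of _ "n + 1 + i"]) auto
    qed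
    ultimately show ?thesis using N by (intro exI[of _ N] conjI exI[of _ N']) auto
  qed
  with \<epsilon> that show thesis by blast
qed

lemma benford_prob_1_pos: "benford_prob 1 > 0"
  by (simp add: benford_prob_def)

section \<open>Counting functions of infinite sets\<close>

text \<open>For infinite \<open>T\<close> this is the number of elements of \<open>T\<close> up to
  \<open>N\<close>: \<open>enumerate\<close> starts at 0, so the first index beyond \<open>N\<close>
  equals the count.\<close>

definition occurrences_upto :: "nat set \<Rightarrow> nat \<Rightarrow> nat" where
  "occurrences_upto T N = (LEAST j. N < enumerate T j)"

lemma less_occurrences_upto_iff:
  assumes "infinite T"
  shows "j < occurrences_upto T N \<longleftrightarrow> enumerate T j \<le> N"
proof -
  have "N < enumerate T (Suc N)"
    using le_enumerate[OF assms, of "Suc N"] by simp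
  then have "N < enumerate T (occurrences_upto T N)"
    unfolding occurrences_upto_def by (rule LeastI)
  moreover have "enumerate T (occurrences_upto T N) \<le> enumerate T j" if "occurrences_upto T N \<le> j"
    using that assms by (simp add: enumerate_mono_le_iff)
  ultimately show ?thesis
    unfolding occurrences_upto_def by (metis leD le_less_linear less_le_trans not_less_Least)
qed

lemma occurrences_upto_le:
  assumes "infinite T"
  shows "occurrences_upto T N \<le> N + 1"
  using less_occurrences_upto_iff[OF assms, of "N + 1" N] le_enumerate[OF assms, of "N + 1"]
  by linarith

text \<open>Each of the \<open>j\<close> consecutive blocks of length \<open>q\<close> after
  \<open>N\<close> contains an element of \<open>T\<close>, so each raises the count.\<close>

lemma occurrences_upto_add_ge:
  assumes inf: "infinite T"
    and hit: "\<And>n. N \<le> n \<Longrightarrow> n + q \<le> N' \<Longrightarrow> \<exists>t\<in>T. n < t \<and> t \<le> n + q"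
    and "N + q * j \<le> N'"
  shows "occurrences_upto T N + j \<le> occurrences_upto T (N + q * j)"
  using \<open>N + q * j \<le> N'\<close>
proof (induction j)
  case (Suc j)
  obtain t where t: "t \<in> T" "N + q * j < t" "t \<le> N + q * Suc j"
    using hit[of "N + q * j"] Suc.prems by (auto simp: algebra_simps)
  obtain i where "t = enumerate T i"
    using t(1) enumerate_Ex[OF inf] by metis
  with t have "occurrences_upto T (N + q * j) \<le> i" "i < occurrences_upto T (N + q * Suc j)"
    using less_occurrences_upto_iff[OF inf] by (metis leD not_less)+
  with Suc show ?case by simp
qed simp

section \<open>Contradiction with both Benford properties\<close>

theorem theorem2p9:
  fixes a :: "nat \<Rightarrow> real"
  assumes pos: "\<And>n. n \<ge> 1 \<Longrightarrow> a n > 0"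
    and diff_at_top: "filterlim (log_diff a) at_top sequentially"
    and diff_slow: "(\<lambda>n. log_diff a (n + 1) - log_diff a n) \<in> O(\<lambda>n. 1 / real n)"
  shows "(\<forall>k\<ge>2. \<not> locally_benford k a) \<and> \<not> benford_waiting_times a"
proof (intro conjI allI impI notI)
  obtain \<epsilon> where \<epsilon>: "\<epsilon> > 0"
    and win: "\<And>M. \<exists>N\<ge>M. \<exists>N'. (1 + \<epsilon>) * real N \<le> real N' \<and>
       (\<forall>n\<in>{N..N'}. \<not> (leading_digit (a n) = 1 \<and> leading_digit (a (n + 1)) = 1)) \<and>
       (\<forall>n. N \<le> n \<and> n + 5 \<le> N' \<longrightarrow> (\<exists>t\<in>{n<..n + 5}. leading_digit (a t) = 1))"
    using windows_leading_digit_one[OF assms] by blast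
  {
    fix k :: nat
    assume k: "k \<ge> 2" and "locally_benford k a"
    \<comment> \<open>As \<open>k \<ge> 2\<close>, the all-ones pattern starts with two ones, so no
      window contributes to \<open>c\<close>, although its density would be positive.\<close>
    define c where "c N = card {n \<in> {1..N}. \<forall>i<k. leading_digit (a (n + i)) = 1}" for N
    have "\<forall>i<k. 1 \<in> {1..9::nat}" by simp
    with \<open>locally_benford k a\<close> have "(\<lambda>N. real (c N) / real N) \<longlonglongrightarrow> (\<Prod>i<k. benford_prob 1)"
      unfolding locally_benford_def c_def by (elim allE[of _ "\<lambda>_. 1"]) auto
    moreover have "(\<Prod>i<k. benford_prob 1) > 0"
      using benford_prob_1_pos by (intro prod_pos) auto
    ultimately obtain M where M: "\<And>N N'. N \<ge> M \<Longrightarrow> (1 + \<epsilon>) * real N \<le> real N' \<Longrightarrow> c N < c N'"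
      using counts_increase_of_density \<epsilon> by blast
    obtain N N' where N: "N \<ge> M" "(1 + \<epsilon>) * real N \<le> real N'"
      and no: "\<And>n. n \<in> {N..N'} \<Longrightarrow> \<not> (leading_digit (a n) = 1 \<and> leading_digit (a (n + 1)) = 1)"
      using win[of M] by blast
    have "{n \<in> {1..N'}. \<forall>i<k. leading_digit (a (n + i)) = 1}
        \<subseteq> {n \<in> {1..N}. \<forall>i<k. leading_digit (a (n + i)) = 1}"
    proof safe
      fix n assume n: "n \<in> {1..N'}" and one: "\<forall>i<k. leading_digit (a (n + i)) = 1"
      have "leading_digit (a n) = 1" "leading_digit (a (n + 1)) = 1"
        using one[rule_format, of 0] one[rule_format, of 1] k by auto
      with no[of n] n show "n \<in> {1..N}" by (cases "N \<le> n") auto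
    qed
    then have "c N' \<le> c N" unfolding c_def by (intro card_mono) auto
    with M[OF N] show False by simp
  }
  {
    assume wait: "benford_waiting_times a"
    define T where "T = digit_indices a 1"
    define A where "A = occurrences_upto T"
    define c where "c N = card {i \<in> {1..N}. waiting_time a 1 i = 1}" for N
    have inf: "infinite T" and "(\<lambda>N. real (c N) / real N) \<longlonglongrightarrow> benford_prob 1"
      using wait unfolding benford_waiting_times_def T_def c_def by (force dest!: bspec[of _ _ 1])+
    \<comment> \<open>Here \<open>c\<close> counts by occurrence number, so windows are measured by
      \<open>A\<close>. One occurrence per five indices lets \<open>A\<close> grow by about
      \<open>\<epsilon> N / 5\<close>, while \<open>A N \<le> N + 1\<close>; half of this rate is
      given up for rounding.\<close>
    then obtain M where M: "\<And>N N'. N \<ge> M \<Longrightarrow> (1 + \<epsilon> / 10) * real N \<le> real N' \<Longrightarrow> c N < c N'"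
      using counts_increase_of_density[of c _ "\<epsilon> / 10"] benford_prob_1_pos \<epsilon>
      by (meson divide_pos_pos zero_less_numeral)
    \<comment> \<open>The first summand forces \<open>M < A N\<close>; the others give
      \<open>\<epsilon> N \<ge> 10 + \<epsilon>\<close>, exactly what the rounding losses
      require.\<close>
    define L where "L = enumerate T M + nat \<lceil>10 / \<epsilon>\<rceil> + 1"
    obtain N N' where N: "N \<ge> L" and N': "(1 + \<epsilon>) * real N \<le> real N'"
      and no: "\<And>n. n \<in> {N..N'} \<Longrightarrow> \<not> (leading_digit (a n) = 1 \<and> leading_digit (a (n + 1)) = 1)"
      and hit: "\<And>n. N \<le> n \<Longrightarrow> n + 5 \<le> N' \<Longrightarrow> \<exists>t\<in>{n<..n + 5}. leading_digit (a t) = 1"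
      using win[of L] by blast
    have "real N \<le> (1 + \<epsilon>) * real N" using \<epsilon> by (simp add: algebra_simps)
    with N' have NN': "N \<le> N'" by simp
    have "M < A N"
      unfolding A_def less_occurrences_upto_iff[OF inf] using N by (simp add: L_def)
    moreover have "(1 + \<epsilon> / 10) * real (A N) \<le> real (A N')"
    proof -
      define j where "j = (N' - N) div 5"
      have "N + 5 * j \<le> N'" unfolding j_def using NN' by linarith
      moreover have "\<exists>t\<in>T. n < t \<and> t \<le> n + 5" if n: "N \<le> n" "n + 5 \<le> N'" for n
      proof -
        obtain t where "n < t" "t \<le> n + 5" "leading_digit (a t) = 1" using hit[OF n] by auto
        then show ?thesis unfolding T_def digit_indices_def by (intro bexI[of _ t]) auto
      qed
      ultimately have "A N + j \<le> A (N + 5 * j)"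
        unfolding A_def by (intro occurrences_upto_add_ge[OF inf]) auto
      also have "A (N + 5 * j) \<le> A N'"
        using \<open>N + 5 * j \<le> N'\<close> less_occurrences_upto_iff[OF inf]
        unfolding A_def by (metis le_trans not_less order_refl)
      finally have "real (A N) + real j \<le> real (A N')" by linarith
      moreover have "N' \<le> N + 5 * j + 5"
        unfolding j_def using NN' by linarith
      then have "real N' \<le> real (N + 5 * j + 5)" by (rule of_nat_mono)
      then have "real j \<ge> (real N' - real N) / 5 - 1" by (simp add: field_simps)
      moreover have "real N \<ge> 10 / \<epsilon> + 1" using N unfolding L_def by linarith
      then have "\<epsilon> * real N \<ge> 10 + \<epsilon>" using \<epsilon> by (simp add: field_simps)
      moreover have "\<epsilon> * real (A N) \<le> \<epsilon> * (real N + 1)"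
        using occurrences_upto_le[OF inf, of N] \<epsilon> unfolding A_def by (intro mult_left_mono) linarith+
      ultimately show ?thesis using N' by (simp add: algebra_simps)
    qed
    ultimately have "c (A N) < c (A N')" by (intro M) auto
    moreover have "{i \<in> {1..A N'}. waiting_time a 1 i = 1} \<subseteq> {i \<in> {1..A N}. waiting_time a 1 i = 1}"
    proof safe
      fix i assume i: "i \<in> {1..A N'}" and w: "waiting_time a 1 i = 1"
      define n where "n = enumerate T (i - 1)"
      \<comment> \<open>The occurrence numbered \<open>i\<close> is
        \<open>enumerate T (i - 1)\<close>, and a truncated difference equal to 1 is a true one. So
        \<open>n\<close> and \<open>n + 1\<close> both have digit 1, which places \<open>n\<close>
        outside the window, hence before \<open>N\<close>.\<close>
      have "enumerate T i = n + 1"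
        using w i unfolding waiting_time_def digit_occurrence_def n_def T_def by simp
      then have "n \<in> T" "n + 1 \<in> T"
        using enumerate_in_set[OF inf] unfolding n_def by metis+
      then have "n \<notin> {N..N'}" using no[of n] unfolding T_def digit_indices_def by auto
      moreover have "i - 1 < A N'" using i by auto
      then have "n \<le> N'" unfolding A_def n_def less_occurrences_upto_iff[OF inf] .
      ultimately have "i - 1 < A N"
        unfolding A_def less_occurrences_upto_iff[OF inf] n_def by auto
      with i show "i \<in> {1..A N}" by auto
    qed
    then have "c (A N') \<le> c (A N)" unfolding c_def by (intro card_mono) auto
    ultimately show False by simp
  }
qed

end
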